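(* Let $\mathcal{G}$ be a stochastic game with rewards that is stopping under fairness, and let $\pi_2$ be a fair semi-Markov Player 2 strategy. Then for every vertex $v$ and every Player 1 strategy $\pi_1$ there is a semi-Markov Player 1 strategy $\pi_1^*$ such that $\mathbb{E}^{\pi_1,\pi_2}_{\mathcal{G},v}[\mathrm{rew}]=\mathbb{E}^{\pi_1^*,\pi_2}_{\mathcal{G},v}[\mathrm{rew}]$.
   Context: A stochastic game is a tuple $\mathcal{G}=(V,(V_1,V_2,V_P),\delta)$ where $V$ is a finite set of vertices, $V_1,V_2,V_P$ form a partition of $V$, and $\delta:V\times V\to[0,1]$ satisfies $\delta(v,v')\in\{0,1\}$ for $v\in V_1\cup V_2$, $v'\in V$, and $\delta(v,\cdot)$ is a probability distribution on $V$ for $v\in V_P$. Let $\mathrm{post}(v)=\{v'\mid \delta(v,v')>0\}$; it is assumed $\mathrm{post}(v)\neq\emptyset$ for all $v$. A vertex $v$ is terminal if $\delta(v,v)=1$ and $\delta(v,v')=0$ for $v'\neq v$; $T$ is the set of terminal vertices. A path is an infinite sequence $\omega=v_0v_1\dots$ with $\delta(v_k,v_{k+1})>0$ for all $k$; $\inf(\omega)$ is the set of vertices occurring infinitely often in $\omega$. A strategy for Player $i\in\{1,2\}$ is a function $\pi_i:V^*V_i\to\mathcal{D}(V)$ with $\pi_i(\hat\omega u)(u')>0$ only if $u'\in\mathrm{post}(u)$. A strategy $\pi_i$ is semi-Markov if $\pi_i(u\hat\omega u')=\pi_i(u\hat\omega' u')$ for every $u\in V$ and all $\hat\omega,\hat\omega'\in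 V^*$ with $|\hat\omega|=|\hat\omega'|$. Given strategies $\pi_1,\pi_2$ and initial vertex $v$, $\Pr^{\pi_1,\pi_2}_{\mathcal{G},v}$ is the induced probability measure on paths starting at $v$. $\Diamond T$ is the set of paths visiting $T$. Fair plays: $FP^2=\{\omega\mid \forall v'\in V_2:\ v'\in\inf(\omega)\Rightarrow \mathrm{post}(v')\subseteq\inf(\omega)\}$; a Player 2 strategy $\pi_2$ is fair if $\Pr^{\pi_1,\pi_2}_{\mathcal{G},u}(FP^2)=1$ for every Player 1 strategy $\pi_1$ and every $u\in V$. $\mathcal{G}$ is stopping under fairness if $\Pr^{\pi_1,\pi_2}_{\mathcal{G},u}(\Diamond T)=1$ for all Player 1 strategies $\pi_1$, all fair Player 2 strategies $\pi_2$, and all $u\in V$. A stochastic game with rewards additionally has a reward function $r:V\to\mathbb{R}_{\ge0}$ with $r(u)=0$ for every terminal $u$; $\mathrm{rew}(\omega)=\sum_{i\ge0}r(\omega_i)$ and $\mathbb{E}^{\pi_1,\pi_2}_{\mathcal{G},v}[\mathrm{rew}]$ is the expectation of $\mathrm{rew}$ under $\Pr^{\pi_1,\pi_2}_{\mathcal{G},v}$. *)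

theory Defs
  imports "HOL-Probability.Probability"
begin

text \<open>
  The finite vertex set of a game is the whole of a type of class \<^class>\<open>finite\<close>.
\<close>

record 'v stochastic_game =
  player1 :: "'v set"
  player2 :: "'v set"
  probabilistic :: "'v set"
  trans_prob :: "'v \<Rightarrow> 'v \<Rightarrow> real"

record 'v reward_game = "'v stochastic_game" +
  reward :: "'v \<Rightarrow> real"

definition post :: "('v::finite, 'b) stochastic_game_scheme \<Rightarrow> 'v \<Rightarrow> 'v set" where
  "post G v = {v'. trans_prob G v v' > 0}"

definition stochastic_game :: "('v::finite, 'b) stochastic_game_scheme \<Rightarrow> bool" where
  "stochastic_game G \<longleftrightarrow>
     player1 G \<union> player2 G \<union> probabilistic G = UNIV \<and>
     player1 G \<inter> player2 G = {} \<and>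
     player1 G \<inter> probabilistic G = {} \<and>
     player2 G \<inter> probabilistic G = {} \<and>
     (\<forall>v v'. trans_prob G v v' \<in> {0..1}) \<and>
     (\<forall>v\<in>player1 G \<union> player2 G. \<forall>v'. trans_prob G v v' \<in> {0, 1}) \<and>
     (\<forall>v\<in>probabilistic G. (\<Sum>v'\<in>UNIV. trans_prob G v v') = 1) \<and>
     (\<forall>v. post G v \<noteq> {})"

definition terminals :: "('v::finite, 'b) stochastic_game_scheme \<Rightarrow> 'v set" where
  "terminals G = {v. trans_prob G v v = 1 \<and> (\<forall>v'. v' \<noteq> v \<longrightarrow> trans_prob G v v' = 0)}"

definition stochastic_game_with_rewards :: "('v::finite, 'b) reward_game_scheme \<Rightarrow> bool" where
  "stochastic_game_with_rewards G \<longleftrightarrow>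
     stochastic_game G \<and> (\<forall>u. reward G u \<ge> 0) \<and> (\<forall>u\<in>terminals G. reward G u = 0)"

text \<open>
  A strategy of the player owning the vertices \<open>W\<close> is a function on nonempty histories ending
  in \<open>W\<close>; the current vertex is the last element of the list.  Its values on all other lists
  are unconstrained and are never used.
\<close>

definition strategy ::
    "('v::finite, 'b) stochastic_game_scheme \<Rightarrow> 'v set \<Rightarrow> ('v list \<Rightarrow> 'v pmf) \<Rightarrow> bool" where
  "strategy G W \<pi> \<longleftrightarrow> (\<forall>h. \<forall>u\<in>W. \<forall>u'. pmf (\<pi> (h @ [u])) u' > 0 \<longrightarrow> u' \<in> post G u)"

definition semi_markov :: "'v set \<Rightarrow> ('v list \<Rightarrow> 'v pmf) \<Rightarrow> bool" where
  "semi_markov W \<pi> \<longleftrightarrow>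
     (\<forall>u h h'. \<forall>u'\<in>W. length h = length h' \<longrightarrow> \<pi> (u # h @ [u']) = \<pi> (u # h' @ [u']))"

definition next_vertex ::
    "('v::finite, 'b) stochastic_game_scheme \<Rightarrow> ('v list \<Rightarrow> 'v pmf) \<Rightarrow> ('v list \<Rightarrow> 'v pmf)
      \<Rightarrow> 'v list \<Rightarrow> 'v pmf" where
  "next_vertex G \<pi>\<^sub>1 \<pi>\<^sub>2 h =
     (if last h \<in> player1 G then \<pi>\<^sub>1 h
      else if last h \<in> player2 G then \<pi>\<^sub>2 h
      else embed_pmf (trans_prob G (last h)))"

definition step_kernel ::
    "('v::finite, 'b) stochastic_game_scheme \<Rightarrow> ('v list \<Rightarrow> 'v pmf) \<Rightarrow> ('v list \<Rightarrow> 'v pmf)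
      \<Rightarrow> 'v \<Rightarrow> nat \<Rightarrow> (nat \<Rightarrow> 'v) \<Rightarrow> 'v measure" where
  "step_kernel G \<pi>\<^sub>1 \<pi>\<^sub>2 v n \<omega> =
     measure_pmf (if n = 0 then return_pmf v else next_vertex G \<pi>\<^sub>1 \<pi>\<^sub>2 (map \<omega> [0..<n]))"

text \<open>
  The measure lives on all sequences of vertices.  It is the Ionescu-Tulcea limit of the step
  kernels; lemma \<open>emeasure_path_measure_cylinder\<close> below gives its value on cylinders.
\<close>

definition path_measure ::
    "('v::finite, 'b) stochastic_game_scheme \<Rightarrow> ('v list \<Rightarrow> 'v pmf) \<Rightarrow> ('v list \<Rightarrow> 'v pmf)
      \<Rightarrow> 'v \<Rightarrow> (nat \<Rightarrow> 'v) measure" where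
  "path_measure G \<pi>\<^sub>1 \<pi>\<^sub>2 v =
     projective_family.lim UNIV
       (Ionescu_Tulcea.CI (step_kernel G \<pi>\<^sub>1 \<pi>\<^sub>2 v) (\<lambda>_. count_space UNIV))
       (\<lambda>_. count_space UNIV)"

lemma Ionescu_Tulcea_step_kernel:
  "Ionescu_Tulcea (step_kernel G \<pi>\<^sub>1 \<pi>\<^sub>2 v) (\<lambda>_. count_space (UNIV :: 'v::finite set))"
proof (rule Ionescu_Tulcea.intro)
  show "step_kernel G \<pi>\<^sub>1 \<pi>\<^sub>2 v i
      \<in> measurable (PiM {0..<i} (\<lambda>_. count_space UNIV)) (subprob_algebra (count_space UNIV))" for i
    by (subst count_space_PiM_finite)
       (auto simp: step_kernel_def intro!: measure_pmf_in_subprob_algebra)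
  show "prob_space (step_kernel G \<pi>\<^sub>1 \<pi>\<^sub>2 v i x)" for i x
    by (simp add: step_kernel_def prob_space_measure_pmf)
qed

lemma sets_path_measure:
  "sets (path_measure G \<pi>\<^sub>1 \<pi>\<^sub>2 v) = sets (PiM UNIV (\<lambda>_. count_space (UNIV :: 'v::finite set)))"
proof -
  interpret Ionescu_Tulcea "step_kernel G \<pi>\<^sub>1 \<pi>\<^sub>2 v" "\<lambda>_. count_space (UNIV :: 'v set)"
    by (rule Ionescu_Tulcea_step_kernel)
  show ?thesis by (simp add: path_measure_def)
qed

lemma prob_space_path_measure: "prob_space (path_measure G \<pi>\<^sub>1 \<pi>\<^sub>2 (v :: 'v::finite))"
proof -
  interpret Ionescu_Tulcea "step_kernel G \<pi>\<^sub>1 \<pi>\<^sub>2 v" "\<lambda>_. count_space (UNIV :: 'v set)"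
    by (rule Ionescu_Tulcea_step_kernel)
  have "emeasure PF.lim (prod_emb UNIV (\<lambda>_. count_space UNIV) {} (space (PiM {} (\<lambda>_. count_space UNIV))))
      = emeasure (CI {}) (space (PiM {} (\<lambda>_. count_space UNIV)))"
    by (rule lim) auto
  also have "\<dots> = 1"
    using prob_space.emeasure_space_1[OF PF.prob_space_P[of "{}"]] PF.space_P[of "{}"] by simp
  finally show ?thesis
    by (intro prob_spaceI)
       (simp add: path_measure_def prod_emb_def space_PiM vimage_def restrict_def)
qed

lemma emeasure_path_measure_cylinder:
  fixes G :: "('v::finite, 'b) stochastic_game_scheme" and x :: "nat \<Rightarrow> 'v"
  shows "emeasure (path_measure G \<pi>\<^sub>1 \<pi>\<^sub>2 v) {\<omega>. \<forall>i\<le>n. \<omega> i = x i} =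
     (if x 0 = v then
        ennreal (\<Prod>i<n. pmf (next_vertex G \<pi>\<^sub>1 \<pi>\<^sub>2 (map x [0..<Suc i])) (x (Suc i)))
      else 0)"
proof -
  let ?M = "\<lambda>_::nat. count_space (UNIV :: 'v set)"
  let ?q = "\<lambda>n. if n = 0 then return_pmf v else next_vertex G \<pi>\<^sub>1 \<pi>\<^sub>2 (map x [0..<n])"
  interpret Ionescu_Tulcea "step_kernel G \<pi>\<^sub>1 \<pi>\<^sub>2 v" ?M
    by (rule Ionescu_Tulcea_step_kernel)
  have sets: "A \<in> sets (PiM {0..<m} ?M) \<longleftrightarrow> A \<subseteq> space (PiM {0..<m} ?M)" for m A
    by (subst (1 2) count_space_PiM_finite) auto
  have meas: "f \<in> borel_measurable (PiM {0..<m} ?M)" for m and f :: "(nat \<Rightarrow> 'v) \<Rightarrow> ennreal"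
    by (subst count_space_PiM_finite) auto
  have und: "(\<lambda>_. undefined) \<in> space (PiM {0..<0} ?M)"
    by (simp add: space_PiM)
  have C: "emeasure (C 0 m (\<lambda>_. undefined)) {restrict x {0..<m}} = ennreal (\<Prod>i<m. pmf (?q i) (x i))"
    for m
  proof (induction m)
    case 0
    then show ?case by (simp add: sets[of _ 0, simplified] space_PiM restrict_def indicator_def)
  next
    case (Suc m)
    let ?A = "{restrict x {0..<Suc m}}"
    have A: "?A \<in> sets (PiM {0..<Suc m} ?M)"
      unfolding sets by (auto simp: space_PiM)
    have eP: "emeasure (eP m \<omega>) ?A = ennreal (pmf (?q m) (x m)) * indicator {restrict x {0..<m}} \<omega>"
      if \<omega>: "\<omega> \<in> space (PiM {0..<m} ?M)" for \<omega>
    proof -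
      have ext: "\<omega> \<in> extensional {0..<m}"
        using \<omega> by (auto simp: space_PiM PiE_def)
      have upd: "fun_upd \<omega> m y = restrict x {0..<Suc m} \<longleftrightarrow> \<omega> = restrict x {0..<m} \<and> y = x m" for y
      proof
        assume eq: "fun_upd \<omega> m y = restrict x {0..<Suc m}"
        have "\<omega> i = restrict x {0..<m} i" for i
          using fun_cong[OF eq, of i] ext
          by (cases "i < m"; cases "i = m") (auto simp: extensional_def)
        then show "\<omega> = restrict x {0..<m} \<and> y = x m"
          using fun_cong[OF eq, of m] by auto
      qed (auto simp: fun_eq_iff less_Suc_eq)
      have "(\<lambda>y. fun_upd \<omega> m y) -` ?A = (if \<omega> = restrict x {0..<m} then {x m} else {})"
        unfolding vimage_def singleton_iff upd by auto
      moreover have hist: "map (restrict x {0..<m}) [0..<m] = map x [0..<m]"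
        by auto
      ultimately show ?thesis
        by (auto simp: emeasure_eP[OF \<omega> A] step_kernel_def emeasure_pmf_single hist)
    qed
    have "emeasure (C 0 (Suc m) (\<lambda>_. undefined)) ?A
        = (\<integral>\<^sup>+\<omega>. emeasure (eP m \<omega>) ?A \<partial>C 0 m (\<lambda>_. undefined))"
      using und measurable_C[of 0 m] A
      by (simp only: C.simps add_0)
         (rule emeasure_bind[where N = "PiM {0..<Suc m} ?M"],
          auto simp: space_C measurable_cong_sets[OF sets_C])
    also have "\<dots> = (\<integral>\<^sup>+\<omega>. ennreal (pmf (?q m) (x m)) * indicator {restrict x {0..<m}} \<omega>
        \<partial>C 0 m (\<lambda>_. undefined))"
      using und by (intro nn_integral_cong eP) (simp add: space_C)
    also have "\<dots> = ennreal (pmf (?q m) (x m)) * emeasure (C 0 m (\<lambda>_. undefined)) {restrict x {0..<m}}"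
      using und by (intro nn_integral_cmult_indicator) (simp add: sets_C sets[of _ m, simplified] space_PiM)
    also have "\<dots> = ennreal (\<Prod>i<Suc m. pmf (?q i) (x i))"
      by (simp only: Suc.IH prod.lessThan_Suc ennreal_mult[symmetric] prod_nonneg pmf_nonneg mult.commute)
    finally show ?case .
  qed
  have "{\<omega>. \<forall>i\<le>n. \<omega> i = x i} = prod_emb UNIV ?M {0..<Suc n} {restrict x {0..<Suc n}}"
    by (simp add: prod_emb_def space_PiM fun_eq_iff restrict_def less_Suc_eq_le set_eq_iff)
  then have "emeasure (path_measure G \<pi>\<^sub>1 \<pi>\<^sub>2 v) {\<omega>. \<forall>i\<le>n. \<omega> i = x i}
      = emeasure (CI {0..<Suc n}) {restrict x {0..<Suc n}}"
    by (simp only: path_measure_def) (rule lim, auto simp: sets space_PiM)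
  also have "\<dots> = emeasure (C 0 (Suc n) (\<lambda>_. undefined))
      (prod_emb {0..<Suc n} ?M {0..<Suc n} {restrict x {0..<Suc n}})"
    by (rule emeasure_CI) (auto simp: sets space_PiM)
  also have "prod_emb {0..<Suc n} ?M {0..<Suc n} {restrict x {0..<Suc n}} = {restrict x {0..<Suc n}}"
    by (rule prod_emb_id) (auto simp: space_PiM)
  also have "emeasure (C 0 (Suc n) (\<lambda>_. undefined)) {restrict x {0..<Suc n}}
      = ennreal (\<Prod>i<Suc n. pmf (?q i) (x i))"
    by (rule C)
  also have "(\<Prod>i<Suc n. pmf (?q i) (x i)) = (if x 0 = v then
        (\<Prod>i<n. pmf (next_vertex G \<pi>\<^sub>1 \<pi>\<^sub>2 (map x [0..<Suc i])) (x (Suc i))) else 0)"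
    by (subst prod.lessThan_Suc_shift) (simp del: upt_Suc)
  finally show ?thesis by simp
qed

definition paths :: "('v::finite, 'b) stochastic_game_scheme \<Rightarrow> (nat \<Rightarrow> 'v) set" where
  "paths G = {\<omega>. \<forall>k. trans_prob G (\<omega> k) (\<omega> (Suc k)) > 0}"

definition inf_set :: "(nat \<Rightarrow> 'v) \<Rightarrow> 'v set" where
  "inf_set \<omega> = {v. \<exists>\<^sub>\<infinity>k. \<omega> k = v}"

definition reach :: "('v::finite, 'b) stochastic_game_scheme \<Rightarrow> 'v set \<Rightarrow> (nat \<Rightarrow> 'v) set" where
  "reach G S = {\<omega>\<in>paths G. \<exists>k. \<omega> k \<in> S}"

definition fair_plays :: "('v::finite, 'b) stochastic_game_scheme \<Rightarrow> (nat \<Rightarrow> 'v) set" where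
  "fair_plays G = {\<omega>\<in>paths G. \<forall>v'\<in>player2 G. v' \<in> inf_set \<omega> \<longrightarrow> post G v' \<subseteq> inf_set \<omega>}"

definition fair_strategy ::
    "('v::finite, 'b) stochastic_game_scheme \<Rightarrow> ('v list \<Rightarrow> 'v pmf) \<Rightarrow> bool" where
  "fair_strategy G \<pi>\<^sub>2 \<longleftrightarrow>
     strategy G (player2 G) \<pi>\<^sub>2 \<and>
     (\<forall>\<pi>\<^sub>1 u. strategy G (player1 G) \<pi>\<^sub>1 \<longrightarrow>
        measure (path_measure G \<pi>\<^sub>1 \<pi>\<^sub>2 u) (fair_plays G) = 1)"

definition stopping_under_fairness :: "('v::finite, 'b) stochastic_game_scheme \<Rightarrow> bool" where
  "stopping_under_fairness G \<longleftrightarrow>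
     (\<forall>\<pi>\<^sub>1 \<pi>\<^sub>2 u. strategy G (player1 G) \<pi>\<^sub>1 \<longrightarrow> fair_strategy G \<pi>\<^sub>2 \<longrightarrow>
        measure (path_measure G \<pi>\<^sub>1 \<pi>\<^sub>2 u) (reach G (terminals G)) = 1)"

text \<open>
  Rewards are nonnegative, so the total reward and its expectation are taken in \<open>[0, \<infinity>]\<close>.
\<close>

definition total_reward :: "('v::finite, 'b) reward_game_scheme \<Rightarrow> (nat \<Rightarrow> 'v) \<Rightarrow> ennreal" where
  "total_reward G \<omega> = (\<Sum>i. ennreal (reward G (\<omega> i)))"

definition expected_reward ::
    "('v::finite, 'b) reward_game_scheme \<Rightarrow> ('v list \<Rightarrow> 'v pmf) \<Rightarrow> ('v list \<Rightarrow> 'v pmf)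
      \<Rightarrow> 'v \<Rightarrow> ennreal" where
  "expected_reward G \<pi>\<^sub>1 \<pi>\<^sub>2 v = (\<integral>\<^sup>+\<omega>. total_reward G \<omega> \<partial>path_measure G \<pi>\<^sub>1 \<pi>\<^sub>2 v)"

end

theory Submission
  imports Defs
begin

text \<open>
  The expected total reward only depends on the one-time marginals of the path measure.  The
  strategy that, at time \<open>n\<close> in vertex \<open>w\<close>, plays the average of the given strategy over the
  histories conditioned on being in \<open>w\<close> at time \<open>n\<close> has the same marginals: starting from a
  fixed vertex, a semi-Markov Player 2 strategy also sees only \<open>n\<close> and \<open>w\<close>, so both marginal
  processes satisfy the same recurrence.
\<close>

section \<open>Laws of finite histories\<close>

text \<open>The index counts moves, so the lists have length \<open>n + 1\<close>. Working with a
  discrete law makes conditioning on the current vertex elementary.\<close>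

primrec history_pmf ::
    "('v::finite, 'b) stochastic_game_scheme \<Rightarrow> ('v list \<Rightarrow> 'v pmf) \<Rightarrow> ('v list \<Rightarrow> 'v pmf)
      \<Rightarrow> 'v \<Rightarrow> nat \<Rightarrow> 'v list pmf" where
  "history_pmf G \<pi>\<^sub>1 \<pi>\<^sub>2 v 0 = return_pmf [v]"
| "history_pmf G \<pi>\<^sub>1 \<pi>\<^sub>2 v (Suc n) =
     bind_pmf (history_pmf G \<pi>\<^sub>1 \<pi>\<^sub>2 v n)
       (\<lambda>h. map_pmf (\<lambda>u. h @ [u]) (next_vertex G \<pi>\<^sub>1 \<pi>\<^sub>2 h))"

lemma set_history_pmf:
  assumes "h \<in> set_pmf (history_pmf G \<pi>\<^sub>1 \<pi>\<^sub>2 v n)"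
  shows "length h = Suc n \<and> hd h = v"
  using assms by (induction n arbitrary: h) (fastforce simp: hd_append)+

text \<open>The right-hand side has the shape of the cylinder formula for
  \<open>path_measure\<close>, so that the two laws can be compared atom by atom.\<close>

lemma pmf_history_pmf:
  fixes x :: "nat \<Rightarrow> 'v::finite"
  shows "pmf (history_pmf G \<pi>\<^sub>1 \<pi>\<^sub>2 v n) (map x [0..<Suc n]) =
     (if x 0 = v then
        (\<Prod>i<n. pmf (next_vertex G \<pi>\<^sub>1 \<pi>\<^sub>2 (map x [0..<Suc i])) (x (Suc i)))
      else 0)"
proof (induction n)
  case 0
  then show ?case by (simp add: indicator_def)
next
  case (Suc n)
  let ?h = "map x [0..<Suc n]"
  \<comment> \<open>A list determines its prefix, so only one history contributes to the mixture
    formed by \<open>bind_pmf\<close>.\<close>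
  have "pmf (map_pmf (\<lambda>u. h @ [u]) (next_vertex G \<pi>\<^sub>1 \<pi>\<^sub>2 h)) (?h @ [x (Suc n)]) =
      pmf (next_vertex G \<pi>\<^sub>1 \<pi>\<^sub>2 ?h) (x (Suc n)) * indicator {?h} h" for h
  proof (cases "h = ?h")
    case True
    have "inj (\<lambda>u. ?h @ [u])" by (simp add: inj_on_def)
    from pmf_map_inj'[OF this, of "next_vertex G \<pi>\<^sub>1 \<pi>\<^sub>2 ?h" "x (Suc n)"] show ?thesis
      using True by (simp del: upt_Suc)
  next
    case False
    then show ?thesis by (simp add: pmf_eq_0_set_pmf image_iff del: upt_Suc)
  qed
  then have "pmf (history_pmf G \<pi>\<^sub>1 \<pi>\<^sub>2 v (Suc n)) (?h @ [x (Suc n)]) =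
      pmf (next_vertex G \<pi>\<^sub>1 \<pi>\<^sub>2 ?h) (x (Suc n)) * pmf (history_pmf G \<pi>\<^sub>1 \<pi>\<^sub>2 v n) ?h"
    by (simp add: pmf_bind measure_pmf_single del: upt_Suc)
  moreover have "map x [0..<Suc (Suc n)] = ?h @ [x (Suc n)]" by simp
  ultimately show ?case by (simp add: Suc.IH del: upt_Suc history_pmf.simps)
qed

lemma measurable_prefix:
  "(\<lambda>\<omega>. map \<omega> [0..<n]) \<in> measurable (path_measure G \<pi>\<^sub>1 \<pi>\<^sub>2 (v :: 'v::finite)) (count_space UNIV)"
  unfolding measurable_cong_sets[OF sets_path_measure refl]
proof (induction n)
  case (Suc n)
  \<comment> \<open>Prefixes take countably many values, so the prefix may be held fixed while the
    coordinate \<open>\<omega> n\<close> varies.\<close>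
  have "(\<lambda>\<omega>. (\<lambda>h. h @ [\<omega> n]) (map \<omega> [0..<n])) \<in>
      measurable (PiM UNIV (\<lambda>_. count_space (UNIV :: 'v set))) (count_space UNIV)"
    by (rule measurable_compose_countable[OF _ Suc.IH])
      (rule measurable_compose[OF measurable_component_singleton], auto)
  then show ?case by simp
qed simp

text \<open>Lists over a finite type are countable, so singletons suffice: those of length
  \<open>n + 1\<close> are cylinders, all others are null on both sides.\<close>

lemma distr_path_measure_prefix:
  fixes G :: "('v::finite, 'b) stochastic_game_scheme"
  shows "distr (path_measure G \<pi>\<^sub>1 \<pi>\<^sub>2 v) (count_space UNIV) (\<lambda>\<omega>. map \<omega> [0..<Suc n]) =
    measure_pmf (history_pmf G \<pi>\<^sub>1 \<pi>\<^sub>2 v n)"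
proof (rule measure_eqI_countable[where A = UNIV])
  let ?P = "path_measure G \<pi>\<^sub>1 \<pi>\<^sub>2 v" and ?H = "history_pmf G \<pi>\<^sub>1 \<pi>\<^sub>2 v n"
  have sp: "space ?P = UNIV"
    using sets_eq_imp_space_eq[OF sets_path_measure, of G \<pi>\<^sub>1 \<pi>\<^sub>2 v] by (simp add: space_PiM)
  fix h :: "'v list"
  have "emeasure (distr ?P (count_space UNIV) (\<lambda>\<omega>. map \<omega> [0..<Suc n])) {h} =
      emeasure ?P {\<omega>. map \<omega> [0..<Suc n] = h}"
    by (subst emeasure_distr[OF measurable_prefix]) (simp_all add: sp vimage_def del: upt_Suc)
  also have "\<dots> = ennreal (pmf ?H h)"
  proof (cases "length h = Suc n")
    case True
    then have h: "h = map (\<lambda>i. h ! i) [0..<Suc n]"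
      by (metis map_nth)
    then have "{\<omega>. map \<omega> [0..<Suc n] = h} = {\<omega>. \<forall>i\<le>n. \<omega> i = h ! i}"
      using True by (auto simp: list_eq_iff_nth_eq less_Suc_eq_le simp del: upt_Suc)
    then show ?thesis
      using pmf_history_pmf[of G \<pi>\<^sub>1 \<pi>\<^sub>2 v n "\<lambda>i. h ! i"] h
      by (simp add: emeasure_path_measure_cylinder del: upt_Suc)
  next
    case False
    then have "{\<omega>. map \<omega> [0..<Suc n] = h} = {}"
      by (auto simp del: upt_Suc)
    moreover have "pmf ?H h = 0"
      using False set_history_pmf by (fastforce simp: pmf_eq_0_set_pmf)
    ultimately show ?thesis by simp
  qed
  finally show "emeasure (distr ?P (count_space UNIV) (\<lambda>\<omega>. map \<omega> [0..<Suc n])) {h} =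
      emeasure (measure_pmf ?H) {h}"
    by (simp add: emeasure_pmf_single)
qed auto

section \<open>One-time marginals and the expected reward\<close>

definition vertex_pmf ::
    "('v::finite, 'b) stochastic_game_scheme \<Rightarrow> ('v list \<Rightarrow> 'v pmf) \<Rightarrow> ('v list \<Rightarrow> 'v pmf)
      \<Rightarrow> 'v \<Rightarrow> nat \<Rightarrow> 'v pmf" where
  "vertex_pmf G \<pi>\<^sub>1 \<pi>\<^sub>2 v n = map_pmf last (history_pmf G \<pi>\<^sub>1 \<pi>\<^sub>2 v n)"

lemma vertex_pmf_0: "vertex_pmf G \<pi>\<^sub>1 \<pi>\<^sub>2 v 0 = return_pmf v"
  by (simp add: vertex_pmf_def)

lemma vertex_pmf_Suc:
  "vertex_pmf G \<pi>\<^sub>1 \<pi>\<^sub>2 v (Suc n) = bind_pmf (history_pmf G \<pi>\<^sub>1 \<pi>\<^sub>2 v n) (next_vertex G \<pi>\<^sub>1 \<pi>\<^sub>2)"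
  by (simp add: vertex_pmf_def map_bind_pmf pmf.map_comp o_def)

text \<open>Nonnegativity lets sum and integral be exchanged, even for an infinite value; each
  summand then sees only the vertex at one time.\<close>

lemma expected_reward_eq_suminf:
  "expected_reward G \<pi>\<^sub>1 \<pi>\<^sub>2 v =
     (\<Sum>n. \<integral>\<^sup>+u. ennreal (reward G u) \<partial>measure_pmf (vertex_pmf G \<pi>\<^sub>1 \<pi>\<^sub>2 v n))"
proof -
  let ?P = "path_measure G \<pi>\<^sub>1 \<pi>\<^sub>2 v"
  have "(\<lambda>\<omega>. ennreal (reward G (last (map \<omega> [0..<Suc n])))) \<in> borel_measurable ?P" for n
    by (rule measurable_compose[OF measurable_prefix]) simp
  then have "expected_reward G \<pi>\<^sub>1 \<pi>\<^sub>2 v = (\<Sum>n. \<integral>\<^sup>+\<omega>. ennreal (reward G (\<omega> n)) \<partial>?P)"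
    by (simp add: expected_reward_def total_reward_def nn_integral_suminf)
  moreover have "(\<integral>\<^sup>+\<omega>. ennreal (reward G (\<omega> n)) \<partial>?P) =
      (\<integral>\<^sup>+u. ennreal (reward G u) \<partial>measure_pmf (vertex_pmf G \<pi>\<^sub>1 \<pi>\<^sub>2 v n))" for n
  proof -
    have "(\<integral>\<^sup>+\<omega>. ennreal (reward G (\<omega> n)) \<partial>?P) =
        (\<integral>\<^sup>+h. ennreal (reward G (last h)) \<partial>distr ?P (count_space UNIV) (\<lambda>\<omega>. map \<omega> [0..<Suc n]))"
      by (subst nn_integral_distr[OF measurable_prefix]) simp_all
    then show ?thesis by (simp add: distr_path_measure_prefix vertex_pmf_def del: upt_Suc)
  qed
  ultimately show ?thesis by simp
qed

section \<open>The averaged strategy\<close>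

text \<open>Law of total probability: drawing the value of \<open>g\<close> first and then a point
  of \<open>p\<close> conditioned on that value reproduces \<open>p\<close>.\<close>

lemma bind_pmf_disintegrate:
  "bind_pmf p f = bind_pmf (map_pmf g p) (\<lambda>y. bind_pmf (cond_pmf p {x. g x = y}) f)"
proof -
  have "bind_pmf (map_pmf g p) (\<lambda>y. cond_pmf p {x. g x = y}) = p"
  proof (rule bind_cond_pmf_cancel)
    show "measure p {x. g x = y'} = measure (map_pmf g p) {y. g x = y}" if "g x = y'" for x y'
      using that by (simp add: vimage_def eq_commute)
  qed auto
  then show ?thesis by (metis bind_assoc_pmf)
qed

text \<open>Only the length and last vertex of \<open>h\<close> enter, which makes it semi-Markov.
  Where the conditioning event is null, the default consults \<open>\<pi>\<^sub>1\<close> on a fixed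
  list ending in \<open>w\<close>, which keeps the move legal.\<close>

definition averaged_strategy ::
    "('v::finite, 'b) stochastic_game_scheme \<Rightarrow> ('v list \<Rightarrow> 'v pmf) \<Rightarrow> ('v list \<Rightarrow> 'v pmf)
      \<Rightarrow> 'v \<Rightarrow> 'v list \<Rightarrow> 'v pmf" where
  "averaged_strategy G \<pi>\<^sub>1 \<pi>\<^sub>2 v h =
     (let n = length h - 1; w = last h; H = history_pmf G \<pi>\<^sub>1 \<pi>\<^sub>2 v n
      in if w \<in> set_pmf (vertex_pmf G \<pi>\<^sub>1 \<pi>\<^sub>2 v n)
         then bind_pmf (cond_pmf H {h. last h = w}) \<pi>\<^sub>1
         else \<pi>\<^sub>1 (replicate n w @ [w]))"

lemma semi_markov_averaged_strategy: "semi_markov W (averaged_strategy G \<pi>\<^sub>1 \<pi>\<^sub>2 v)"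
  by (simp add: semi_markov_def averaged_strategy_def)

lemma set_cond_history_pmf:
  assumes "w \<in> set_pmf (vertex_pmf G \<pi>\<^sub>1 \<pi>\<^sub>2 v n)"
  shows "set_pmf (cond_pmf (history_pmf G \<pi>\<^sub>1 \<pi>\<^sub>2 v n) {h. last h = w}) =
    {h \<in> set_pmf (history_pmf G \<pi>\<^sub>1 \<pi>\<^sub>2 v n). last h = w}"
  using assms by (subst set_cond_pmf) (auto simp: vertex_pmf_def)

lemma strategy_averaged_strategy:
  assumes "strategy G W \<pi>\<^sub>1"
  shows "strategy G W (averaged_strategy G \<pi>\<^sub>1 \<pi>\<^sub>2 v)"
  unfolding strategy_def
proof (intro allI ballI impI)
  fix h u u'
  assume u: "u \<in> W" and "pmf (averaged_strategy G \<pi>\<^sub>1 \<pi>\<^sub>2 v (h @ [u])) u' > 0"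
  then have u': "u' \<in> set_pmf (averaged_strategy G \<pi>\<^sub>1 \<pi>\<^sub>2 v (h @ [u]))"
    by (simp add: pmf_positive_iff)
  have legal: "u' \<in> post G u" if "u' \<in> set_pmf (\<pi>\<^sub>1 (h' @ [u]))" for h'
    using that assms u by (auto simp: strategy_def pmf_positive_iff)
  show "u' \<in> post G u"
  proof (cases "u \<in> set_pmf (vertex_pmf G \<pi>\<^sub>1 \<pi>\<^sub>2 v (length h))")
    case True
    \<comment> \<open>A move in the support of the average is a move of \<open>\<pi>\<^sub>1\<close>
      after some history that also ends in \<open>u\<close>.\<close>
    with u' obtain k where k: "k \<in> set_pmf (history_pmf G \<pi>\<^sub>1 \<pi>\<^sub>2 v (length h))" "last k = u"
      "u' \<in> set_pmf (\<pi>\<^sub>1 k)"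
      by (auto simp: averaged_strategy_def set_cond_history_pmf)
    then have "k = butlast k @ [u]"
      using set_history_pmf[OF k(1)] by (metis append_butlast_last_id list.size(3) nat.distinct(1))
    with k(3) show ?thesis using legal by metis
  next
    case False
    with u' show ?thesis by (auto simp: averaged_strategy_def intro: legal)
  qed
qed

section \<open>Equality of the marginals\<close>

lemma semi_markov_cong:
  assumes "semi_markov W \<pi>" "hd h = hd h'" "length h = length h'" "last h = last h'"
    "h \<noteq> []" "last h \<in> W"
  shows "\<pi> h = \<pi> h'"
proof -
  have ne: "h' \<noteq> []"
    using assms(3,5) by auto
  have split: "k = hd k # butlast (tl k) @ [last k]" if "k \<noteq> []" "tl k \<noteq> []" for k :: "'a list"
    using that append_butlast_last_id[of "tl k"] last_tl[of k] hd_Cons_tl[of k] by simp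
  show ?thesis
  proof (cases "tl h = []")
    \<comment> \<open>\<open>semi_markov\<close> speaks only of lists with at least two entries;
      one-vertex histories with equal heads are simply equal.\<close>
    case True
    then have "tl h' = []"
      using assms(3) by (metis length_0_conv length_tl)
    with True assms(2,5) ne have "h = h'"
      by (metis hd_Cons_tl)
    then show ?thesis by simp
  next
    case False
    then have "tl h' \<noteq> []"
      using assms(3) by (metis length_0_conv length_tl)
    moreover have "length (butlast (tl h)) = length (butlast (tl h'))"
      using assms(3) by simp
    then have "\<pi> (hd h # butlast (tl h) @ [last h]) = \<pi> (hd h # butlast (tl h') @ [last h])"
      using assms(1,6) unfolding semi_markov_def by blast
    ultimately show ?thesis
      using split[OF assms(5) False] split[OF ne] assms(2,4) by metis
  qed
qed

text \<open>At a Player 1 vertex this is how the average was defined. Elsewhere the next move is the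
  same after all the conditioned histories, and averaging a constant changes nothing.\<close>

lemma bind_cond_next_vertex:
  assumes \<pi>\<^sub>2: "semi_markov (player2 G) \<pi>\<^sub>2"
    and h: "length h = Suc n" "hd h = v" "last h \<in> set_pmf (vertex_pmf G \<pi>\<^sub>1 \<pi>\<^sub>2 v n)"
  shows "bind_pmf (cond_pmf (history_pmf G \<pi>\<^sub>1 \<pi>\<^sub>2 v n) {k. last k = last h}) (next_vertex G \<pi>\<^sub>1 \<pi>\<^sub>2) =
    next_vertex G (averaged_strategy G \<pi>\<^sub>1 \<pi>\<^sub>2 v) \<pi>\<^sub>2 h"
proof -
  let ?C = "cond_pmf (history_pmf G \<pi>\<^sub>1 \<pi>\<^sub>2 v n) {k. last k = last h}"
  have C: "last k = last h \<and> length k = length h \<and> hd k = hd h" if "k \<in> set_pmf ?C" for k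
    using that h(1,2) set_history_pmf[of k] unfolding set_cond_history_pmf[OF h(3)] by force
  show ?thesis
  proof (cases "last h \<in> player1 G")
    case True
    have "next_vertex G \<pi>\<^sub>1 \<pi>\<^sub>2 k = \<pi>\<^sub>1 k" if "k \<in> set_pmf ?C" for k
      unfolding next_vertex_def C[OF that, THEN conjunct1] using True by simp
    then have "bind_pmf ?C (next_vertex G \<pi>\<^sub>1 \<pi>\<^sub>2) = bind_pmf ?C \<pi>\<^sub>1"
      by (intro bind_pmf_cong) auto
    then show ?thesis
      using True h by (simp add: next_vertex_def averaged_strategy_def)
  next
    case False
    \<comment> \<open>The common start \<open>v\<close> is essential, since a semi-Markov strategy
      may depend on the first vertex.\<close>
    have "\<pi>\<^sub>2 k = \<pi>\<^sub>2 h" if "k \<in> set_pmf ?C" "last h \<in> player2 G" for k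
      using C[OF that(1)] that(2) h(1) by (intro semi_markov_cong[OF \<pi>\<^sub>2]; force)
    then have "next_vertex G \<pi>\<^sub>1 \<pi>\<^sub>2 k = next_vertex G (averaged_strategy G \<pi>\<^sub>1 \<pi>\<^sub>2 v) \<pi>\<^sub>2 h"
      if "k \<in> set_pmf ?C" for k
      unfolding next_vertex_def C[OF that, THEN conjunct1] using False that by simp
    then have "bind_pmf ?C (next_vertex G \<pi>\<^sub>1 \<pi>\<^sub>2) =
        bind_pmf ?C (\<lambda>_. next_vertex G (averaged_strategy G \<pi>\<^sub>1 \<pi>\<^sub>2 v) \<pi>\<^sub>2 h)"
      by (intro bind_pmf_cong) auto
    then show ?thesis by simp
  qed
qed

lemma vertex_pmf_averaged_strategy:
  assumes "semi_markov (player2 G) \<pi>\<^sub>2"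
  shows "vertex_pmf G (averaged_strategy G \<pi>\<^sub>1 \<pi>\<^sub>2 v) \<pi>\<^sub>2 v n = vertex_pmf G \<pi>\<^sub>1 \<pi>\<^sub>2 v n"
proof (induction n)
  case 0
  then show ?case by (simp add: vertex_pmf_0)
next
  case (Suc n)
  let ?\<pi> = "averaged_strategy G \<pi>\<^sub>1 \<pi>\<^sub>2 v"
  let ?K = "\<lambda>w. bind_pmf (cond_pmf (history_pmf G \<pi>\<^sub>1 \<pi>\<^sub>2 v n) {k. last k = w}) (next_vertex G \<pi>\<^sub>1 \<pi>\<^sub>2)"
  have "next_vertex G ?\<pi> \<pi>\<^sub>2 h = ?K (last h)" if h: "h \<in> set_pmf (history_pmf G ?\<pi> \<pi>\<^sub>2 v n)" for h
  proof (rule bind_cond_next_vertex[OF assms, symmetric])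
    \<comment> \<open>By the induction hypothesis, a vertex reached at time \<open>n\<close> under
      the new strategy is also reached under the old one, so the default branch is never met
      here.\<close>
    show "last h \<in> set_pmf (vertex_pmf G \<pi>\<^sub>1 \<pi>\<^sub>2 v n)"
      using h by (simp add: Suc.IH[symmetric]) (simp add: vertex_pmf_def)
  qed (use set_history_pmf[OF h] in auto)
  then have "vertex_pmf G ?\<pi> \<pi>\<^sub>2 v (Suc n) = bind_pmf (history_pmf G ?\<pi> \<pi>\<^sub>2 v n) (\<lambda>h. ?K (last h))"
    unfolding vertex_pmf_Suc by (intro bind_pmf_cong) auto
  also have "\<dots> = bind_pmf (vertex_pmf G ?\<pi> \<pi>\<^sub>2 v n) ?K"
    by (simp add: vertex_pmf_def bind_map_pmf)
  \<comment> \<open>Splitting the original histories by their last vertex exposes the same kernel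
    \<open>?K\<close>.\<close>
  also have "\<dots> = bind_pmf (vertex_pmf G \<pi>\<^sub>1 \<pi>\<^sub>2 v n) ?K"
    by (simp add: Suc.IH)
  also have "\<dots> = vertex_pmf G \<pi>\<^sub>1 \<pi>\<^sub>2 v (Suc n)"
    unfolding vertex_pmf_Suc by (subst (2) bind_pmf_disintegrate[where g = last])
      (simp add: vertex_pmf_def)
  finally show ?case .
qed

theorem theorem4:
  fixes G :: "'v::finite reward_game"
    and \<pi>\<^sub>2 :: "'v list \<Rightarrow> 'v pmf"
  assumes "stochastic_game_with_rewards G"
    and "stopping_under_fairness G"
    and "fair_strategy G \<pi>\<^sub>2"
    and "semi_markov (player2 G) \<pi>\<^sub>2"
  shows "\<forall>v. \<forall>\<pi>\<^sub>1. strategy G (player1 G) \<pi>\<^sub>1 \<longrightarrow>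
           (\<exists>\<pi>\<^sub>1'. strategy G (player1 G) \<pi>\<^sub>1' \<and> semi_markov (player1 G) \<pi>\<^sub>1' \<and>
              expected_reward G \<pi>\<^sub>1 \<pi>\<^sub>2 v = expected_reward G \<pi>\<^sub>1' \<pi>\<^sub>2 v)"
proof (intro allI impI exI conjI)
  fix v \<pi>\<^sub>1
  assume "strategy G (player1 G) \<pi>\<^sub>1"
  then show "strategy G (player1 G) (averaged_strategy G \<pi>\<^sub>1 \<pi>\<^sub>2 v)"
    by (rule strategy_averaged_strategy)
  show "semi_markov (player1 G) (averaged_strategy G \<pi>\<^sub>1 \<pi>\<^sub>2 v)"
    by (rule semi_markov_averaged_strategy)
  \<comment> \<open>The witness is built from the given \<open>v\<close>; equal marginals make the
    two reward series agree term by term.\<close>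
  show "expected_reward G \<pi>\<^sub>1 \<pi>\<^sub>2 v = expected_reward G (averaged_strategy G \<pi>\<^sub>1 \<pi>\<^sub>2 v) \<pi>\<^sub>2 v"
    using assms(4) by (simp add: expected_reward_eq_suminf vertex_pmf_averaged_strategy)
qed

end
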